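(* Let $(X,\bullet)$ be a strong groupoid. Then $(X,\bullet)$ has a $UA$-factorization, i.e. $(X,\bullet)=U(X,\bullet)\diamond A(X,\bullet)$.
   Context: A groupoid $(X,\bullet)$ is a non-empty set $X$ with an arbitrary binary operation $\bullet:X\times X\to X$. It is strong if for all $x,y\in X$, $x\bullet y=y\bullet x$ implies $x=y$. For groupoids $(X,\ast)$, $(X,\circ)$ on the same set $X$, the product $(X,\ast)\diamond(X,\circ)$ is the groupoid $(X,\cdot)$ with $x\cdot y=(x\ast y)\circ(y\ast x)$ for all $x,y\in X$. The signature-factor $U(X,\bullet)=(X,\ast)$ is defined by $x\ast x=x$ and $x\ast y=x\bullet y$ for $x\neq y$. The similar-factor $A(X,\bullet)=(X,\circ)$ is defined by $x\circ x=x\bullet x$ and $x\circ y=x$ for $x\neq y$. *)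

theory Defs
  imports "HOL-Algebra.Congruence" "HOL-Library.FuncSet"
begin

record 'a groupoid = "'a partial_object" +
  gop :: "'a \<times> 'a \<Rightarrow> 'a"

text \<open>The operation is required to be extensional (undefined off the carrier), so that equality
  of records is equality of groupoids: same set and same operation on that set.\<close>

definition groupoid :: "'a groupoid \<Rightarrow> bool" where
  "groupoid G \<longleftrightarrow>
     carrier G \<noteq> {} \<and> gop G \<in> carrier G \<times> carrier G \<rightarrow>\<^sub>E carrier G"

definition strong_groupoid :: "'a groupoid \<Rightarrow> bool" where
  "strong_groupoid G \<longleftrightarrow> groupoid G \<and>
     (\<forall>x\<in>carrier G. \<forall>y\<in>carrier G. gop G (x, y) = gop G (y, x) \<longrightarrow> x = y)"

text \<open>The product is only meaningful for groupoids on the same set; the carrier is taken from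
  the left factor.\<close>

definition groupoid_prod :: "'a groupoid \<Rightarrow> 'a groupoid \<Rightarrow> 'a groupoid"
    (infixl \<open>\<diamondop>\<close> 70) where
  "G \<diamondop> H =
     \<lparr>carrier = carrier G,
      gop = (\<lambda>(x, y)\<in>carrier G \<times> carrier G. gop H (gop G (x, y), gop G (y, x)))\<rparr>"

definition signature_factor :: "'a groupoid \<Rightarrow> 'a groupoid" where
  "signature_factor G =
     \<lparr>carrier = carrier G,
      gop = (\<lambda>(x, y)\<in>carrier G \<times> carrier G. if x = y then x else gop G (x, y))\<rparr>"

definition similar_factor :: "'a groupoid \<Rightarrow> 'a groupoid" where
  "similar_factor G =
     \<lparr>carrier = carrier G,
      gop = (\<lambda>(x, y)\<in>carrier G \<times> carrier G. if x = y then gop G (x, x) else x)\<rparr>"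

definition has_UA_factorization :: "'a groupoid \<Rightarrow> bool" where
  "has_UA_factorization G \<longleftrightarrow> G = signature_factor G \<diamondop> similar_factor G"

lemma gop_closed:
  "groupoid G \<Longrightarrow> x \<in> carrier G \<Longrightarrow> y \<in> carrier G \<Longrightarrow> gop G (x, y) \<in> carrier G"
  unfolding groupoid_def by (metis PiE_mem mem_Sigma_iff)

lemma groupoid_signature_factor:
  assumes "groupoid G"
  shows "groupoid (signature_factor G)"
proof -
  have "carrier G \<noteq> {}"
    using assms by (simp add: groupoid_def)
  then show ?thesis
    unfolding groupoid_def signature_factor_def
    by (simp add: restrict_PiE_iff Pi_iff gop_closed[OF assms])
qed

lemma groupoid_similar_factor:
  assumes "groupoid G"
  shows "groupoid (similar_factor G)"
proof -
  have "carrier G \<noteq> {}"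
    using assms by (simp add: groupoid_def)
  then show ?thesis
    unfolding groupoid_def similar_factor_def
    by (simp add: restrict_PiE_iff Pi_iff gop_closed[OF assms])
qed

lemma groupoid_groupoid_prod:
  assumes "groupoid G" "groupoid H" "carrier G = carrier H"
  shows "groupoid (G \<diamondop> H)"
proof -
  have "carrier H \<noteq> {}"
    using assms(2) by (simp add: groupoid_def)
  then show ?thesis
    unfolding groupoid_def groupoid_prod_def
    using gop_closed[OF assms(1)] gop_closed[OF assms(2)]
    by (simp add: restrict_PiE_iff Pi_iff assms(3))
qed

end

theory Submission
  imports Defs
begin

text \<open>For distinct x and y, the signature-factor supplies the pair of products of x, y in both
  orders. Strongness makes these two values distinct, so the similar-factor acts as left projection
  and returns the product of x and y. On the diagonal, the signature-factor fixes x and the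
  similar-factor restores its square.\<close>

theorem theorem3p1p3:
  fixes G :: "'a groupoid"
  assumes "strong_groupoid G"
  shows "has_UA_factorization G"
proof -
  have G: "groupoid G"
    and strong: "\<And>x y. x \<in> carrier G \<Longrightarrow> y \<in> carrier G \<Longrightarrow> x \<noteq> y \<Longrightarrow> gop G (x, y) \<noteq> gop G (y, x)"
    using assms by (auto simp: strong_groupoid_def)
  let ?P = "signature_factor G \<diamondop> similar_factor G"
  have carrier: "carrier ?P = carrier G"
    by (simp add: groupoid_prod_def signature_factor_def)
  have "gop ?P (x, y) = gop G (x, y)" for x y
  proof (cases "x \<in> carrier G \<and> y \<in> carrier G")
    case True
    \<comment> \<open>\<open>gop_closed\<close> puts both inner products in the carrier, where the
      restricted operation of the similar-factor takes its intended value.\<close>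
    then show ?thesis
      using strong
      by (cases "x = y")
        (simp_all add: groupoid_prod_def signature_factor_def similar_factor_def gop_closed[OF G])
  next
    case False
    \<comment> \<open>Record equality compares the operations on all pairs; outside the carrier both
      are \<open>undefined\<close> by extensionality.\<close>
    then have "gop G (x, y) = undefined"
      using G PiE_arb[of "gop G" "carrier G \<times> carrier G" "\<lambda>_. carrier G" "(x, y)"]
      by (simp add: groupoid_def)
    with False show ?thesis
      by (auto simp: groupoid_prod_def signature_factor_def)
  qed
  then have "gop ?P = gop G"
    by auto
  with carrier show ?thesis
    unfolding has_UA_factorization_def by (intro groupoid.equality) simp_all
qed

end
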